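(* Let $k\ge 2$ and $1\le r\le r'$ be integers. Then the spectrum (set of adjacency eigenvalues) of $X_r^k$ is a subset of the spectrum of $X_{r'}^k$.
   Context: $X_r^k$ denotes the $k$-ary rooted tree of depth $r$: a finite tree with a distinguished root in which every node at distance less than $r$ from the root has exactly $k$ children (neighbours one step farther from the root), and the nodes at distance $r$ from the root are the leaves (degree 1). The spectrum of a graph means the set of eigenvalues of its adjacency operator $(Av)_\gamma=\sum_{\beta\sim\gamma}v_\beta$ on complex-valued functions on the nodes. *)

theory Defs
  imports Complex_Main "Graph_Theory.Graph_Theory"
begin

(* In the underlying graph library an undirected simple graph is a finite symmetric loop-free
   digraph without parallel arcs (locale graph), and (u, v), (v, u) count as a directed cycle
   of length 2.  Its constants forest and tree, phrased with directed cycles, therefore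
   do not describe undirected trees.  Under "graph G", cycles in the undirected sense are exactly
   the directed cycles with at least three arcs. *)

definition undirected_tree :: "('a, 'b) pre_digraph \<Rightarrow> bool" where
  "undirected_tree G \<longleftrightarrow>
     graph G \<and> Digraph_Component.connected G \<and>
     \<not> (\<exists>p. pre_digraph.cycle G p \<and> 3 \<le> length p)"

(* Shortest-path distance with unit arc costs, hence the usual graph distance. *)

definition graph_dist :: "('a, 'b) pre_digraph \<Rightarrow> 'a \<Rightarrow> 'a \<Rightarrow> ereal" where
  "graph_dist G u v = wf_digraph.\<mu> G (\<lambda>_. 1) u v"

definition children :: "('a, 'b) pre_digraph \<Rightarrow> 'a \<Rightarrow> 'a \<Rightarrow> 'a set" where
  "children G \<rho> u = {v. u \<rightarrow>\<^bsub>G\<^esub> v \<and> graph_dist G \<rho> v = graph_dist G \<rho> u + 1}"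

(* "kary_rooted_tree k r G \<rho>" says that G with root \<rho> is (a copy of) the k-ary rooted
   tree of depth r, for r at least 1.  The last clause forces all nodes to have distance at
   most r, since a node at distance r already has a neighbour closer to the root. *)

definition kary_rooted_tree :: "nat \<Rightarrow> nat \<Rightarrow> ('a, 'b) pre_digraph \<Rightarrow> 'a \<Rightarrow> bool" where
  "kary_rooted_tree k r G \<rho> \<longleftrightarrow>
     undirected_tree G \<and> \<rho> \<in> verts G \<and>
     (\<forall>u\<in>verts G. graph_dist G \<rho> u < ereal (real r) \<longrightarrow> card (children G \<rho> u) = k) \<and>
     (\<forall>u\<in>verts G. graph_dist G \<rho> u = ereal (real r) \<longrightarrow> out_degree G u = 1)"

definition adjacency_op :: "('a, 'b) pre_digraph \<Rightarrow> ('a \<Rightarrow> complex) \<Rightarrow> 'a \<Rightarrow> complex" where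
  "adjacency_op G v u = (\<Sum>w | u \<rightarrow>\<^bsub>G\<^esub> w. v w)"

(* Complex-valued functions on the nodes are represented by total functions of which only the
   values on "verts G" matter. *)

definition graph_spectrum :: "('a, 'b) pre_digraph \<Rightarrow> complex set" where
  "graph_spectrum G =
     {c. \<exists>v. (\<exists>u\<in>verts G. v u \<noteq> 0) \<and> (\<forall>u\<in>verts G. adjacency_op G v u = c * v u)}"

(* The predicate kary_rooted_tree is satisfiable: the words of length at most r over k letters,
   with a nonempty word adjacent to its tail, form such a tree with root []. *)

definition word_tree :: "nat \<Rightarrow> nat \<Rightarrow> (nat list, nat list \<times> nat list) pre_digraph" where
  "word_tree k r =
     (let V = {w. set w \<subseteq> {..<k} \<and> length w \<le> r};
          E = {(w, tl w) | w. w \<in> V \<and> w \<noteq> []}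
      in \<lparr>verts = V, arcs = E \<union> E\<inverse>, tail = fst, head = snd\<rparr>)"

lemma verts_word_tree: "verts (word_tree k r) = {w. set w \<subseteq> {..<k} \<and> length w \<le> r}"
  by (simp add: word_tree_def Let_def)

lemma word_tree_ends: "tail (word_tree k r) = fst" "head (word_tree k r) = snd"
  by (simp_all add: word_tree_def Let_def)

lemma arcs_word_tree:
  "(u, v) \<in> arcs (word_tree k r) \<longleftrightarrow>
     u \<in> verts (word_tree k r) \<and> v \<in> verts (word_tree k r) \<and>
     (u \<noteq> [] \<and> v = tl u \<or> v \<noteq> [] \<and> u = tl v)"
  by (auto simp: word_tree_def Let_def dest: list.set_sel(2))

lemma arcs_ends_word_tree: "arcs_ends (word_tree k r) = arcs (word_tree k r)"
  by (auto simp: arcs_ends_conv word_tree_ends)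

lemma graph_word_tree: "graph (word_tree k r)"
proof -
  have fin: "finite (verts (word_tree k r))"
    unfolding verts_word_tree by (rule finite_lists_length_le) simp
  have "arcs (word_tree k r) \<subseteq> verts (word_tree k r) \<times> verts (word_tree k r)"
    by (auto simp: arcs_word_tree)
  with fin have "finite (arcs (word_tree k r))"
    by (meson finite_SigmaI finite_subset)
  moreover have "tl w \<noteq> w" if "w \<noteq> []" for w :: "nat list"
    using that by (cases w) auto
  ultimately show ?thesis
    using fin
    by unfold_locales
       (auto simp: word_tree_ends arcs_word_tree arc_to_ends_def symmetric_def
          arcs_ends_word_tree sym_def, metis+)
qed

lemma awalk_verts_arc:
  assumes "pre_digraph.cas G u p v" "i < length p"
  shows "tail G (p ! i) = pre_digraph.awalk_verts G u p ! i
       \<and> head G (p ! i) = pre_digraph.awalk_verts G u p ! Suc i"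
  using assms
proof (induction p arbitrary: u i)
  case (Cons e p)
  then show ?case
    by (cases i; cases p) (auto simp: pre_digraph.cas.simps pre_digraph.awalk_verts.simps)
qed simp

lemma length_le_word_tree:
  assumes "pre_digraph.cas (word_tree k r) u p v" "set p \<subseteq> arcs (word_tree k r)"
  shows "length v \<le> length u + length p"
  using assms
proof (induction p arbitrary: u)
  case (Cons e p)
  then have "length v \<le> length (snd e) + length p" and "fst e = u"
    by (auto simp: pre_digraph.cas.simps word_tree_ends)
  moreover have "length (snd e) \<le> Suc (length (fst e))"
    using Cons.prems by (cases e) (auto simp: arcs_word_tree)
  ultimately show ?case by simp
qed (simp add: pre_digraph.cas.simps)

lemma root_walk_word_tree:
  assumes "w \<in> verts (word_tree k r)"
  shows "\<exists>p. pre_digraph.awalk (word_tree k r) [] p w \<and> length p = length w"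
  using assms
proof (induction w)
  case Nil
  then show ?case
    by (intro exI[of _ "[]"]) (simp add: pre_digraph.awalk_def pre_digraph.cas.simps)
next
  case (Cons a w)
  interpret graph "word_tree k r" by (rule graph_word_tree)
  from Cons.prems have "w \<in> verts (word_tree k r)" by (simp add: verts_word_tree)
  with Cons.IH obtain p where p: "awalk [] p w" "length p = length w" by blast
  have "(w, a # w) \<in> arcs (word_tree k r)"
    using Cons.prems \<open>w \<in> verts (word_tree k r)\<close> by (simp add: arcs_word_tree)
  then have "awalk w [(w, a # w)] (a # w)"
    by (simp add: awalk_def word_tree_ends \<open>w \<in> verts (word_tree k r)\<close>)
  with p have "awalk [] (p @ [(w, a # w)]) (a # w)"
    by (simp add: awalk_append_iff)
  with p(2) show ?case by (intro exI[of _ "p @ [(w, a # w)]"]) simp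
qed

lemma graph_dist_word_tree:
  assumes "w \<in> verts (word_tree k r)"
  shows "graph_dist (word_tree k r) [] w = ereal (real (length w))"
proof -
  interpret graph "word_tree k r" by (rule graph_word_tree)
  have cost: "awalk_cost (\<lambda>_. 1) p = real (length p)" for p :: "(nat list \<times> nat list) list"
    by (induction p) (auto simp: awalk_cost_def)
  obtain p where "awalk [] p w" "length p = length w"
    using root_walk_word_tree[OF assms] by blast
  then have "graph_dist (word_tree k r) [] w \<le> ereal (real (length w))"
    unfolding graph_dist_def using min_cost_le_walk_cost[of "[]" p w "\<lambda>_. 1"] by (simp add: cost)
  moreover have "ereal (real (length w)) \<le> graph_dist (word_tree k r) [] w"
    unfolding graph_dist_def \<mu>_def
    using length_le_word_tree[of k r "[]"] by (intro INF_greatest) (auto simp: cost awalk_def)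
  ultimately show ?thesis by simp
qed

lemma no_cycle_word_tree:
  assumes "pre_digraph.cycle (word_tree k r) p" "3 \<le> length p"
  shows False
proof -
  interpret graph "word_tree k r" by (rule graph_word_tree)
  define n where "n = length p"
  from assms(1) obtain u where w: "awalk u p u" and d: "distinct (tl (awalk_verts u p))"
    by (auto simp: cycle_def)
  define vs where "vs = awalk_verts u p"
  have len: "length vs = Suc n" by (simp add: vs_def n_def length_awalk_verts)
  have ends: "vs ! 0 = vs ! n"
  proof -
    have "vs \<noteq> []" using len by auto
    then have "vs ! 0 = hd vs" "vs ! n = last vs"
      using len by (simp_all add: hd_conv_nth last_conv_nth)
    with w show ?thesis by (auto simp: vs_def awalk_def)
  qed
  have neq: "vs ! i \<noteq> vs ! j" if "1 \<le> i" "i < j" "j \<le> n" for i j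
    using that d nth_eq_iff_index_eq[of "tl vs" "i - 1" "j - 1"] len
    by (simp add: vs_def[symmetric] nth_tl)
  have arc: "(vs ! i, vs ! Suc i) \<in> arcs (word_tree k r)" if "i < n" for i
  proof -
    have "p ! i \<in> arcs (word_tree k r)" using w that by (auto simp: awalk_def n_def)
    moreover have "p ! i = (vs ! i, vs ! Suc i)"
      using awalk_verts_arc[of "word_tree k r" u p u i] w that
      by (simp add: word_tree_ends awalk_def vs_def n_def prod_eq_iff)
    ultimately show ?thesis by simp
  qed
  have lower: "v = tl u'" 
    if "(u', v) \<in> arcs (word_tree k r) \<or> (v, u') \<in> arcs (word_tree k r)"
      "length v \<le> length u'" for u' v
    using that by (cases v) (auto simp: arcs_word_tree)
  have "{1..n} \<noteq> {}" using assms(2) by (simp add: n_def)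
  then obtain i where i: "i \<in> {1..n}" "\<And>j. j \<in> {1..n} \<Longrightarrow> length (vs ! j) \<le> length (vs ! i)"
  proof -
    let ?M = "(\<lambda>i. length (vs ! i)) ` {1..n}"
    have "Max ?M \<in> ?M" using \<open>{1..n} \<noteq> {}\<close> by (intro Max_in) auto
    then obtain i where "i \<in> {1..n}" "Max ?M = length (vs ! i)" by (rule imageE)
    moreover have "length (vs ! j) \<le> Max ?M" if "j \<in> {1..n}" for j
      using that by (intro Max_ge) auto
    ultimately show ?thesis using that by metis
  qed
  then have max: "length (vs ! j) \<le> length (vs ! i)" if "j \<le> n" for j
    using that i(1) ends by (cases "j = 0") auto
  have n3: "3 \<le> n" using assms(2) by (simp add: n_def)
  have i1: "Suc (i - 1) = i" "i - 1 < n" using i(1) by auto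
  have prev: "vs ! (i - 1) = tl (vs ! i)"
  proof (rule lower)
    show "(vs ! i, vs ! (i - 1)) \<in> arcs (word_tree k r) \<or>
          (vs ! (i - 1), vs ! i) \<in> arcs (word_tree k r)"
      using arc[OF i1(2)] unfolding i1(1) by blast
    show "length (vs ! (i - 1)) \<le> length (vs ! i)"
      by (rule max) (use i1 in linarith)
  qed
  show False
  proof (cases "i = n")
    case True
    have "vs ! 1 = tl (vs ! n)"
      using arc[of 0] n3 ends max[of 1] True by (intro lower) auto
    with prev True neq[of 1 "n - 1"] n3 show False by simp
  next
    case False
    then have "vs ! Suc i = tl (vs ! i)"
      using arc[of i] i(1) max[of "Suc i"] by (intro lower) auto
    with prev have eq: "vs ! (i - 1) = vs ! Suc i" by simp
    show False
    proof (cases "i = 1")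
      case True
      with eq ends neq[of 2 n] n3 show False by (simp add: numeral_2_eq_2)
    next
      case False
      then have "1 \<le> i - 1" "i - 1 < Suc i" "Suc i \<le> n" using i(1) \<open>i \<noteq> n\<close> by auto
      with eq neq show False by blast
    qed
  qed
qed

lemma connected_word_tree: "Digraph_Component.connected (word_tree k r)"
proof -
  interpret graph "word_tree k r" by (rule graph_word_tree)
  have nil: "[] \<in> verts (word_tree k r)" by (simp add: verts_word_tree)
  have "[] \<rightarrow>\<^sup>*\<^bsub>word_tree k r\<^esub> w" if "w \<in> verts (word_tree k r)" for w
    using root_walk_word_tree[OF that] by (auto simp: reachable_awalk)
  then have "u \<rightarrow>\<^sup>*\<^bsub>word_tree k r\<^esub> v" if "u \<in> verts (word_tree k r)" "v \<in> verts (word_tree k r)" for u v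
    using that symmetric_reachable[OF sym_arcs] reachable_trans by blast
  with nil have "strongly_connected (word_tree k r)"
    by (auto simp: strongly_connected_def)
  then show ?thesis
    by (auto simp: Digraph_Component.connected_def strongly_connected_def
        reachable_mk_symmetric_eq[OF sym_arcs])
qed

lemma kary_rooted_tree_word_tree:
  assumes "1 \<le> r"
  shows "kary_rooted_tree k r (word_tree k r) []"
proof -
  interpret graph "word_tree k r" by (rule graph_word_tree)
  have ch: "children (word_tree k r) [] u = (\<lambda>a. a # u) ` {..<k}"
    if u: "u \<in> verts (word_tree k r)" "length u < r" for u
  proof (rule set_eqI)
    fix v
    have "length v = Suc (length u) \<Longrightarrow> v \<noteq> tl u"
      and "v \<noteq> [] \<Longrightarrow> u = tl v \<Longrightarrow> length v = Suc (length u)"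
      by auto
    then have "(u, v) \<in> arcs (word_tree k r) \<and> length v = Suc (length u) \<longleftrightarrow>
        v \<in> verts (word_tree k r) \<and> v \<noteq> [] \<and> u = tl v"
      using u(1) unfolding arcs_word_tree by meson
    moreover have "v \<in> children (word_tree k r) [] u \<longleftrightarrow>
        (u, v) \<in> arcs (word_tree k r) \<and> length v = Suc (length u)"
    proof (cases "v \<in> verts (word_tree k r)")
      case True
      have "real (length v) = real (length u) + 1 \<longleftrightarrow> length v = Suc (length u)" by linarith
      with True u(1) show ?thesis
        by (simp add: children_def arcs_ends_word_tree graph_dist_word_tree)
    qed (simp add: children_def arcs_ends_word_tree arcs_word_tree)
    moreover have "v \<in> verts (word_tree k r) \<and> v \<noteq> [] \<and> u = tl v \<longleftrightarrow>
        v \<in> (\<lambda>a. a # u) ` {..<k}"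
      using u by (cases v) (auto simp: verts_word_tree)
    ultimately show "v \<in> children (word_tree k r) [] u \<longleftrightarrow> v \<in> (\<lambda>a. a # u) ` {..<k}"
      by blast
  qed
  have inner: "card (children (word_tree k r) [] u) = k"
    if "u \<in> verts (word_tree k r)" "length u < r" for u
    by (simp add: ch[OF that] card_image inj_on_def)
  have leaf: "out_degree (word_tree k r) u = 1"
    if "u \<in> verts (word_tree k r)" "length u = r" for u
  proof -
    have "u \<noteq> []" using that assms by auto
    have "e = (u, tl u)" if e: "e \<in> arcs (word_tree k r)" "fst e = u" for e
    proof -
      obtain v where v: "e = (u, v)" using e(2) by (cases e) auto
      have "length v \<le> length u"
        using e(1) v \<open>length u = r\<close> by (simp add: arcs_word_tree verts_word_tree)
      then have "\<not> (v \<noteq> [] \<and> u = tl v)" by (cases v) auto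
      with e(1) v have "v = tl u" unfolding v arcs_word_tree by blast
      with v show ?thesis by simp
    qed
    moreover have "(u, tl u) \<in> arcs (word_tree k r)"
      using that by (cases u) (use \<open>u \<noteq> []\<close> in \<open>simp_all add: arcs_word_tree verts_word_tree\<close>)
    ultimately have "out_arcs (word_tree k r) u = {(u, tl u)}"
      unfolding out_arcs_def word_tree_ends by (intro equalityI subsetI; blast intro: fst_conv)
    then show ?thesis by (simp add: out_degree_def)
  qed
  show ?thesis
    unfolding kary_rooted_tree_def undirected_tree_def
  proof (intro conjI ballI impI)
    show "\<not> (\<exists>p. cycle p \<and> 3 \<le> length p)" using no_cycle_word_tree by blast
    show "[] \<in> verts (word_tree k r)" by (simp add: verts_word_tree)
  qed (use inner leaf in \<open>simp_all add: graph_word_tree connected_word_tree graph_dist_word_tree\<close>)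
qed

end

theory Submission
  imports Defs
begin

text \<open>
  Let \<open>P\<^sub>0 = 1\<close>, \<open>P\<^sub>1 = c\<close>, \<open>P\<^sub>n\<^sub>+\<^sub>2 = c P\<^sub>n\<^sub>+\<^sub>1 - k P\<^sub>n\<close>.  For an eigenvector \<open>v\<close> with eigenvalue \<open>c\<close>, working
  upwards from the leaves gives \<open>P\<^sub>h\<^sub>+\<^sub>1 v(u) = P\<^sub>h v(parent of u)\<close> at every node \<open>u\<close> of height
  \<open>h\<close>, the right-hand side being \<open>0\<close> at the root; so if none of \<open>P\<^sub>1, \<dots>, P\<^sub>r\<^sub>+\<^sub>1\<close> vanishes, then \<open>v = 0\<close>.
  Conversely, if \<open>P\<^sub>m\<^sub>+\<^sub>1 = 0\<close> with \<open>m < r\<close>, pick two siblings of height \<open>m\<close>: the function that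
  is \<open>P\<^sub>h\<close> below the one, \<open>-P\<^sub>h\<close> below the other, and \<open>0\<close> elsewhere is an eigenvector; for
  \<open>m = r\<close> take \<open>P\<^sub>h\<close> on the whole tree.  Hence the spectrum is the set of zeros of
  \<open>P\<^sub>1, \<dots>, P\<^sub>r\<^sub>+\<^sub>1\<close>, which grows with \<open>r\<close>.
\<close>

section \<open>The spectrum of a tree described by heights and parents\<close>

text \<open>For \<open>k > 0\<close> this is the rescaled Chebyshev polynomial of the second kind
  \<open>k^(n/2) * U_n (c / (2 * sqrt k))\<close>.\<close>

fun subtree_poly :: "nat \<Rightarrow> complex \<Rightarrow> nat \<Rightarrow> complex" where
  "subtree_poly k c 0 = 1"
| "subtree_poly k c (Suc 0) = c"
| "subtree_poly k c (Suc (Suc n)) = c * subtree_poly k c (Suc n) - of_nat k * subtree_poly k c n"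

text \<open>Only this data enters the eigenvector arguments. Levels are counted from the leaves, so
  that the polynomial attached to a node does not depend on \<open>r\<close>. The value
  \<open>par \<rho>\<close> is unconstrained, hence the guards
  \<open>w \<noteq> \<rho>\<close>.\<close>

locale kary_levels =
  fixes G :: "('a, 'b) pre_digraph" and \<rho> :: 'a and k r :: nat
    and height :: "'a \<Rightarrow> nat" and par :: "'a \<Rightarrow> 'a"
  assumes finite_verts: "finite (verts G)"
    and root: "\<rho> \<in> verts G" "height \<rho> = r"
    and height_le: "u \<in> verts G \<Longrightarrow> height u \<le> r"
    and par_in_verts: "u \<in> verts G \<Longrightarrow> u \<noteq> \<rho> \<Longrightarrow> par u \<in> verts G"
    and height_par: "u \<in> verts G \<Longrightarrow> u \<noteq> \<rho> \<Longrightarrow> height (par u) = Suc (height u)"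
    and neighbours: "u \<in> verts G \<Longrightarrow> {w. u \<rightarrow>\<^bsub>G\<^esub> w} =
          {w \<in> verts G. w \<noteq> \<rho> \<and> par w = u} \<union> (if u = \<rho> then {} else {par u})"
    and card_below: "u \<in> verts G \<Longrightarrow> 0 < height u \<Longrightarrow>
          card {w \<in> verts G. w \<noteq> \<rho> \<and> par w = u} = k"
begin

definition below :: "'a \<Rightarrow> 'a set" where
  "below u = {w \<in> verts G. w \<noteq> \<rho> \<and> par w = u}"

lemma finite_below: "finite (below u)"
  using finite_verts by (simp add: below_def)

lemma below_leaf: "u \<in> verts G \<Longrightarrow> height u = 0 \<Longrightarrow> below u = {}"
  using height_par by (force simp: below_def)

lemma height_below: "w \<in> below u \<Longrightarrow> height u = Suc (height w)"
  using height_par by (auto simp: below_def)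

lemma root_iff: "u \<in> verts G \<Longrightarrow> u = \<rho> \<longleftrightarrow> height u = r"
  using height_par[of u] height_le[OF par_in_verts[of u]] root by fastforce

lemma adjacency_op_eq:
  assumes "u \<in> verts G"
  shows "adjacency_op G v u = sum v (below u) + (if u = \<rho> then 0 else v (par u))"
proof (cases "u = \<rho>")
  case True
  then show ?thesis using assms by (simp add: adjacency_op_def neighbours below_def)
next
  case False
  have "par u \<notin> below u"
    using height_below[of "par u" u] height_par[OF assms False] by auto
  then show ?thesis
    using False assms finite_below[of u]
    by (simp add: adjacency_op_def neighbours below_def[symmetric] add.commute)
qed

text \<open>Multiply the eigenvalue equation at \<open>u\<close>, of height \<open>n + 1\<close>, by
  \<open>P (n + 1)\<close>: by induction each of the \<open>k\<close> children then contributes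
  \<open>P n * v u\<close>, and the recurrence collects the factor \<open>P (n + 2)\<close>. The
  cross-multiplied form avoids dividing by a value that may vanish.\<close>

lemma eigenvector_par:
  assumes ev: "\<And>u. u \<in> verts G \<Longrightarrow> adjacency_op G v u = c * v u"
    and "u \<in> verts G"
  shows "subtree_poly k c (Suc (height u)) * v u =
    subtree_poly k c (height u) * (if u = \<rho> then 0 else v (par u))"
  using assms(2)
proof (induction "height u" arbitrary: u)
  case 0
  then show ?case
    using ev[of u] below_leaf[of u] by (simp add: adjacency_op_eq flip: 0(1))
next
  case (Suc n)
  let ?P = "subtree_poly k c" and ?w = "if u = \<rho> then 0 else v (par u)"
  have "?P (Suc n) * v w = ?P n * v u" if "w \<in> below u" for w
    using Suc(1)[of w] that height_below[OF that] Suc(2) by (auto simp: below_def)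
  then have "?P (Suc n) * sum v (below u) = of_nat (card (below u)) * (?P n * v u)"
    by (simp add: sum_distrib_left)
  moreover have "card (below u) = k"
    using card_below[OF Suc(3)] Suc(2) by (simp add: below_def)
  moreover have "c * v u = sum v (below u) + ?w"
    using ev[OF Suc(3)] adjacency_op_eq[OF Suc(3)] by simp
  then have "?P (Suc n) * (c * v u) = ?P (Suc n) * sum v (below u) + ?P (Suc n) * ?w"
    by (metis distrib_left)
  ultimately have "?P (Suc (Suc n)) * v u = ?P (Suc n) * ?w"
    by (simp add: algebra_simps)
  then show ?case using Suc(2) by simp
qed

lemma spectrum_imp_root:
  assumes "c \<in> graph_spectrum G"
  shows "\<exists>j\<in>{1..Suc r}. subtree_poly k c j = 0"
proof (rule ccontr)
  assume "\<not> ?thesis"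
  then have nz: "subtree_poly k c (Suc h) \<noteq> 0" if "h \<le> r" for h
    using that by simp
  obtain v where v: "\<exists>u\<in>verts G. v u \<noteq> 0"
      "\<And>u. u \<in> verts G \<Longrightarrow> adjacency_op G v u = c * v u"
    using assms by (auto simp: graph_spectrum_def)
  \<comment> \<open>The measure \<open>r - height u\<close> is the distance from the root, so zeros
    propagate from parents down to children.\<close>
  have "v u = 0" if "u \<in> verts G" for u
    using that
  proof (induction "r - height u" arbitrary: u rule: less_induct)
    case less
    have "(if u = \<rho> then 0 else v (par u)) = 0"
    proof (cases "u = \<rho>")
      case False
      then have "r - height (par u) < r - height u"
        using height_par[OF less(2) False] height_le[OF par_in_verts[OF less(2) False]] by simp
      then show ?thesis using less(1) par_in_verts less(2) False by auto
    qed simp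
    then show ?case
      using eigenvector_par[OF v(2) less(2)] nz[OF height_le[OF less(2)]] by simp
  qed
  with v(1) show False by blast
qed

text \<open>
  The weight \<open>t\<close> on the nodes of height \<open>m\<close> is extended constantly to the subtrees below them, by
  going up \<open>m - height u\<close> steps from \<open>u\<close>.
\<close>

lemma level_weight_in_spectrum:
  fixes t :: "'a \<Rightarrow> complex"
  assumes j: "subtree_poly k c (Suc m) = 0" "m \<le> r"
    and t: "\<And>w. w \<in> verts G \<Longrightarrow> height w = Suc m \<Longrightarrow> sum t (below w) = 0"
    and k: "0 < k" and nz: "a \<in> verts G" "height a = m" "t a \<noteq> 0"
  shows "c \<in> graph_spectrum G"
proof -
  let ?P = "subtree_poly k c"
  define s where "s u = (if height u \<le> m then t ((par ^^ (m - height u)) u) else 0)" for u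
  define v where "v u = s u * ?P (height u)" for u
  have s_below: "s w = s u" if "w \<in> below u" "height u \<le> m" for u w
  proof -
    have "m - height w = Suc (m - height u)"
      using height_below[OF that(1)] that(2) by simp
    then show ?thesis
      using that height_below[OF that(1)] by (simp add: s_def below_def funpow_swap1)
  qed
  have "\<exists>u\<in>verts G. v u \<noteq> 0"
  proof -
    \<comment> \<open>Descending from \<open>a\<close> to a leaf keeps the weight and reaches
      \<open>P 0 = 1\<close>, so no other value of \<open>P\<close> has to be nonzero.\<close>
    have leaf: "\<exists>u\<in>verts G. height u = 0 \<and> s u = t a"
      if "b \<in> verts G" "height b \<le> m" "s b = t a" for b
      using that
    proof (induction "height b" arbitrary: b)
      case (Suc n)
      then have "card (below b) = k" using card_below[of b] by (simp add: below_def)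
      with k obtain w where w: "w \<in> below b" by fastforce
      with Suc(1)[of w] Suc(2-) s_below[OF w] height_below[OF w] show ?case
        by (auto simp: below_def)
    qed auto
    have "s a = t a" using nz by (simp add: s_def)
    with leaf[of a] nz obtain u where "u \<in> verts G" "height u = 0" "s u = t a" by auto
    with nz show ?thesis by (intro bexI[of _ u]) (simp_all add: v_def)
  qed
  moreover have "adjacency_op G v u = c * v u" if u: "u \<in> verts G" for u
  proof -
    consider "Suc m < height u" | "height u = Suc m" | "height u \<le> m" by linarith
    then show ?thesis
    proof cases
      case 1
      then have "u \<noteq> \<rho> \<Longrightarrow> v (par u) = 0" using height_par[OF u] by (simp add: v_def s_def)
      moreover have "v w = 0" if "w \<in> below u" for w
        using height_below[OF that] 1 by (simp add: v_def s_def)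
      ultimately have "adjacency_op G v u = 0" by (simp add: adjacency_op_eq[OF u])
      then show ?thesis using 1 by (simp add: v_def s_def)
    next
      \<comment> \<open>Here \<open>v u = 0\<close>, and the children, all of height
        \<open>m\<close>, cancel by the assumption on \<open>t\<close>.\<close>
      case 2
      then have "u \<noteq> \<rho> \<Longrightarrow> v (par u) = 0" using height_par[OF u] by (simp add: v_def s_def)
      moreover have "v w = ?P m * t w" if "w \<in> below u" for w
        using height_below[OF that] 2 by (simp add: v_def s_def)
      then have "sum v (below u) = ?P m * sum t (below u)"
        by (simp add: sum_distrib_left)
      ultimately show ?thesis
        using 2 t[OF u] by (simp add: adjacency_op_eq[OF u] v_def s_def)
    next
      case 3
      \<comment> \<open>At height \<open>m\<close> both sides vanish: the parent, if any, carries
        weight \<open>0\<close>, and \<open>P (m + 1) = 0\<close>. At smaller heights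
        \<open>u\<close> and its parent share the same weight.\<close>
      have up: "(if u = \<rho> then 0 else v (par u)) = s u * ?P (Suc (height u))"
      proof (cases "height u = m")
        case True
        then show ?thesis using j height_par[OF u] by (simp add: v_def s_def)
      next
        case False
        with 3 j(2) have "height u < m" "u \<noteq> \<rho>" using root_iff[OF u] by auto
        moreover have "u \<in> below (par u)" using u \<open>u \<noteq> \<rho>\<close> by (simp add: below_def)
        ultimately show ?thesis
          using s_below[of u "par u"] height_par[OF u] by (simp add: v_def)
      qed
      show ?thesis
      proof (cases "height u")
        case 0
        then show ?thesis
          using up by (simp add: adjacency_op_eq[OF u] below_leaf[OF u] v_def)
      next
        case (Suc n)
        have "v w = s u * ?P n" if "w \<in> below u" for w
          using s_below[OF that 3] height_below[OF that] Suc by (simp add: v_def)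
        then have "sum v (below u) = of_nat k * (s u * ?P n)"
          using card_below[OF u] Suc by (simp add: below_def)
        then show ?thesis
          using up Suc by (simp add: adjacency_op_eq[OF u] v_def[of u] algebra_simps)
      qed
    qed
  qed
  ultimately show ?thesis by (auto simp: graph_spectrum_def)
qed

end

lemma (in kary_levels) exists_at_height:
  assumes "0 < k" "h \<le> r"
  shows "\<exists>u\<in>verts G. height u = h"
  using assms(2)
proof (induction h rule: inc_induct)
  case base
  then show ?case using root by blast
next
  case (step h)
  then obtain u where u: "u \<in> verts G" "height u = Suc h" by blast
  then have "card (below u) = k" using card_below[of u] by (simp add: below_def)
  with \<open>0 < k\<close> obtain w where "w \<in> below u" by fastforce
  then show ?case using height_below[of w u] u by (auto simp: below_def)
qed

theorem (in kary_levels) spectrum_iff: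
  assumes "2 \<le> k"
  shows "c \<in> graph_spectrum G \<longleftrightarrow> (\<exists>j\<in>{1..Suc r}. subtree_poly k c j = 0)"
proof
  assume "\<exists>j\<in>{1..Suc r}. subtree_poly k c j = 0"
  then obtain j where "subtree_poly k c j = 0" "1 \<le> j" "j \<le> Suc r" by auto
  then obtain m where m: "subtree_poly k c (Suc m) = 0" "m \<le> r" by (cases j) auto
  have k: "0 < k" using assms by simp
  show "c \<in> graph_spectrum G"
  proof (cases "m = r")
    case True
    show ?thesis
    \<comment> \<open>The condition on weight sums is vacuous, since no node has height
      \<open>r + 1\<close>.\<close>
    proof (rule level_weight_in_spectrum[OF m, where t = "\<lambda>_. 1"])
      show "sum (\<lambda>_. 1) (below w) = (0::complex)" if "w \<in> verts G" "height w = Suc m" for w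
        using that height_le[of w] True by simp
    qed (use k root True in simp_all)
  next
    case False
    then obtain u where u: "u \<in> verts G" "height u = Suc m"
      using exists_at_height[OF k, of "Suc m"] m(2) by auto
    then have "2 \<le> card (below u)" using card_below[of u] assms by (simp add: below_def)
    then obtain a b where ab: "a \<in> below u" "b \<in> below u" "a \<noteq> b"
      using card_le_Suc0_iff_eq[OF finite_below[of u]] by fastforce
    define t :: "'a \<Rightarrow> complex" where "t w = of_bool (w = a) - of_bool (w = b)" for w
    show ?thesis
    proof (rule level_weight_in_spectrum[OF m, where t = t])
      fix w
      \<comment> \<open>As \<open>a\<close> and \<open>b\<close> are siblings, every set of children
        contains both or neither, so their opposite weights cancel.\<close>
      have "a \<in> below w \<longleftrightarrow> w = u" "b \<in> below w \<longleftrightarrow> w = u"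
        using ab by (auto simp: below_def)
      then show "sum t (below w) = 0"
        using finite_below[of w] by (simp add: t_def sum_subtractf of_bool_def sum.delta)
    next
      show "a \<in> verts G" "height a = m" "t a \<noteq> 0"
        using ab height_below[OF ab(1)] u by (auto simp: below_def t_def)
    qed (use k in simp)
  qed
qed (rule spectrum_imp_root)

section \<open>Distance from the root and uniqueness of predecessors\<close>

locale rooted_graph = graph +
  fixes \<rho>
  assumes root_in_verts: "\<rho> \<in> verts G"
    and reachable_root: "u \<in> verts G \<Longrightarrow> \<rho> \<rightarrow>\<^sup>* u"
begin

text \<open>A natural-number version of the \<open>ereal\<close>-valued distance, suited to
  induction.\<close>

definition depth :: "'a \<Rightarrow> nat" where
  "depth u = (LEAST n. \<exists>p. awalk \<rho> p u \<and> length p = n)"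

lemma depth_le: "awalk \<rho> p u \<Longrightarrow> depth u \<le> length p"
  unfolding depth_def by (rule Least_le) blast

lemma depth_walk:
  assumes "u \<in> verts G"
  obtains p where "awalk \<rho> p u" "length p = depth u"
proof -
  have "\<exists>n p. awalk \<rho> p u \<and> length p = n"
    using reachable_root[OF assms] by (auto simp: reachable_awalk)
  then have "\<exists>p. awalk \<rho> p u \<and> length p = depth u"
    unfolding depth_def by (rule LeastI_ex)
  then show ?thesis using that by blast
qed

lemma graph_dist_depth:
  assumes "u \<in> verts G"
  shows "graph_dist G \<rho> u = ereal (real (depth u))"
proof -
  have cost: "awalk_cost (\<lambda>_. 1) p = real (length p)" for p :: "'b list"
    by (induction p) (auto simp: awalk_cost_def)
  obtain p where "awalk \<rho> p u" "length p = depth u" using depth_walk[OF assms] .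
  then have "graph_dist G \<rho> u \<le> ereal (real (depth u))"
    unfolding graph_dist_def using min_cost_le_walk_cost[of \<rho> p u "\<lambda>_. 1"] by (simp add: cost)
  moreover have "ereal (real (depth u)) \<le> graph_dist G \<rho> u"
    unfolding graph_dist_def \<mu>_def
    using depth_le by (intro INF_greatest) (auto simp: cost)
  ultimately show ?thesis by simp
qed

lemma depth_root [simp]: "depth \<rho> = 0"
  using depth_le[of "[]" \<rho>] root_in_verts by (simp add: awalk_Nil_iff)

lemma depth_eq_0_iff: "u \<in> verts G \<Longrightarrow> depth u = 0 \<longleftrightarrow> u = \<rho>"
  by (metis awalk_Nil_iff depth_root depth_walk length_0_conv)

lemma adj_sym: "u \<rightarrow> v \<longleftrightarrow> v \<rightarrow> u"
  using arcs_ends_symmetric[OF sym_arcs] by blast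

lemma adj_awalk:
  assumes "u \<rightarrow> v"
  obtains e where "awalk u [e] v" "awalk_verts u [e] = [u, v]"
proof -
  from assms obtain e where "e \<in> arcs G" "tail G e = u" "head G e = v"
    by (auto simp: arcs_ends_conv)
  then show ?thesis by (intro that[of e]) (auto simp: awalk_simps)
qed

lemma adj_not_loop: "u \<rightarrow> v \<Longrightarrow> u \<noteq> v"
  using no_loops by (fastforce simp: arcs_ends_conv)

lemma depth_adj_le:
  assumes "u \<rightarrow> v"
  shows "depth v \<le> Suc (depth u)"
proof -
  obtain p where p: "awalk \<rho> p u" "length p = depth u"
    using depth_walk[OF adj_in_verts(1)[OF assms]] .
  obtain e where "awalk u [e] v" using adj_awalk[OF assms] .
  then have "awalk \<rho> (p @ [e]) v" using p(1) by (rule awalk_appendI[rotated])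
  then have "depth v \<le> length (p @ [e])" by (rule depth_le)
  then show ?thesis using p(2) by simp
qed

text \<open>Drop the last arc of a shortest walk from the root.\<close>

lemma depth_predecessor:
  assumes "u \<in> verts G" "u \<noteq> \<rho>"
  shows "\<exists>w. u \<rightarrow> w \<and> depth u = Suc (depth w)"
proof -
  obtain p where p: "awalk \<rho> p u" "length p = depth u" using depth_walk[OF assms(1)] .
  with assms(2) obtain q e where q: "p = q @ [e]"
    by (metis awalk_Nil_iff rev_exhaust)
  then have "awalk \<rho> q (tail G e)" "tail G e \<rightarrow> u"
    using p(1) by (auto simp: awalk_simps arcs_ends_conv)
  then have "u \<rightarrow> tail G e" "depth (tail G e) \<le> length q" "depth u \<le> Suc (depth (tail G e))"
    using depth_le depth_adj_le adj_sym by blast+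
  then show ?thesis using p(2) q by (intro exI[of _ "tail G e"]) simp
qed

lemma adj_del_vert: "x \<rightarrow>\<^bsub>del_vert u\<^esub> y \<longleftrightarrow> x \<rightarrow> y \<and> x \<noteq> u \<and> y \<noteq> u"
  by (auto simp: arcs_ends_conv del_vert_simps)

text \<open>Following predecessors from \<open>x\<close> strictly lowers the depth, so every later
  node has depth below that of \<open>u\<close>, while \<open>x\<close> itself differs from
  \<open>u\<close> by assumption.\<close>

lemma reachable_avoiding:
  assumes "u \<in> verts G" "x \<in> verts G" "x \<noteq> u" "depth x \<le> depth u"
  shows "\<rho> \<rightarrow>\<^sup>*\<^bsub>del_vert u\<^esub> x"
  using assms(2-)
proof (induction "depth x" arbitrary: x)
  case 0
  then show ?case using depth_eq_0_iff[of x]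
    by (auto simp: del_vert_simps intro!: wf_digraph.reachable_refl wf_digraph_del_vert)
next
  case (Suc n)
  then have "x \<noteq> \<rho>" using depth_eq_0_iff[of x] by auto
  then obtain w where w: "x \<rightarrow> w" "depth x = Suc (depth w)"
    using depth_predecessor Suc(3) by blast
  then have "w \<noteq> u" "w \<in> verts G" using Suc adj_in_verts by auto
  moreover have "w \<rightarrow>\<^bsub>del_vert u\<^esub> x"
    using adj_sym w(1) \<open>w \<noteq> u\<close> Suc(4) by (simp add: adj_del_vert)
  moreover have "\<rho> \<rightarrow>\<^sup>*\<^bsub>del_vert u\<^esub> w"
    using Suc w(2) \<open>w \<noteq> u\<close> \<open>w \<in> verts G\<close> by simp
  ultimately show ?case
    by (simp add: wf_digraph.reachable_adj_trans[OF wf_digraph_del_vert, of _ _ w])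
qed

text \<open>
  Shortest paths from the root to \<open>x\<close> and to \<open>y\<close> avoid \<open>u\<close>, so two such neighbours would be
  joined by a path that closes up to a cycle through \<open>u\<close>.
\<close>

lemma unique_predecessor:
  assumes acyclic: "\<not> (\<exists>p. cycle p \<and> 3 \<le> length p)"
    and x: "u \<rightarrow> x" "depth x \<le> depth u"
    and y: "u \<rightarrow> y" "depth y \<le> depth u"
  shows "x = y"
proof (rule ccontr)
  assume "x \<noteq> y"
  let ?H = "del_vert u"
  interpret H: wf_digraph ?H by (rule wf_digraph_del_vert)
  have H_sym: "symmetric ?H"
    using adj_sym by (auto simp: symmetric_def sym_def adj_del_vert)
  have u: "u \<in> verts G" "x \<in> verts G" "y \<in> verts G" using x y adj_in_verts by blast+
  have "x \<noteq> u" "y \<noteq> u" using x y adj_not_loop by blast+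
  then have "\<rho> \<rightarrow>\<^sup>*\<^bsub>?H\<^esub> x" "\<rho> \<rightarrow>\<^sup>*\<^bsub>?H\<^esub> y"
    using reachable_avoiding u x(2) y(2) by simp_all
  then have "x \<rightarrow>\<^sup>*\<^bsub>?H\<^esub> y"
    using symmetric_reachable[OF H_sym] H.reachable_trans by blast
  then obtain p where p: "H.apath x p y" unfolding H.reachable_apath by blast
  then have px: "apath x p y"
    using subgraph_apath_imp_apath subgraph_del_vert by blast
  have pu: "u \<notin> set (awalk_verts x p)"
  proof
    assume "u \<in> set (awalk_verts x p)"
    moreover have "H.awalk_verts = awalk_verts"
      by (rule compatible_awalk_verts) (simp add: compatible_def del_vert_simps)
    ultimately have "u \<in> verts ?H"
      using p H.awalk_verts_in_verts[of x p u] by (auto simp: H.apath_def H.awalk_def)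
    then show False by (simp add: del_vert_simps)
  qed
  obtain e where e: "awalk u [e] x" "awalk_verts u [e] = [u, x]" using adj_awalk x(1) .
  obtain f where f: "awalk y [f] u" "awalk_verts y [f] = [y, u]"
    using adj_awalk y(1) adj_sym by blast
  have w: "awalk u ([e] @ (p @ [f])) u"
    using e(1) f(1) px by (intro awalk_appendI) (auto simp: apath_def)
  have "awlast x p = y" using px by (auto simp: apath_def awalk_def)
  then have "awalk_verts x (p @ [f]) = awalk_verts x p @ [u]"
    using awalk_verts_append[of x p "[f]" u] awalk_appendI[of x p y "[f]" u] f px
    by (simp add: apath_def)
  then have "distinct (tl (awalk_verts u (e # p @ [f])))"
    using px pu e w by (auto simp: apath_def awalk_simps)
  with w have "cycle (e # p @ [f])" by (auto simp: cycle_def)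
  \<comment> \<open>Going along an arc and back already counts as a cycle;
    \<open>x \<noteq> y\<close> supplies the third arc.\<close>
  moreover have "p \<noteq> []" using p \<open>x \<noteq> y\<close> by (auto simp: H.apath_Nil_iff)
  then have "3 \<le> length (e # p @ [f])" by (cases p) auto
  ultimately show False using acyclic by blast
qed

end

section \<open>Heights and parents in a k-ary rooted tree\<close>

lemma kary_rooted_tree_levels:
  fixes G :: "('a, 'b) pre_digraph" (structure)
  assumes "kary_rooted_tree k r G \<rho>" "1 \<le> r"
  shows "\<exists>height par. kary_levels G \<rho> k r height par"
proof -
  interpret graph G using assms by (simp add: kary_rooted_tree_def undirected_tree_def)
  interpret rooted_graph G \<rho>
  proof
    show "\<rho> \<in> verts G" using assms by (simp add: kary_rooted_tree_def)
    moreover have "Digraph_Component.connected G"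
      using assms by (simp add: kary_rooted_tree_def undirected_tree_def)
    ultimately show "\<rho> \<rightarrow>\<^sup>* u" if "u \<in> verts G" for u
      using that
      by (simp add: Digraph_Component.connected_def strongly_connected_def
          reachable_mk_symmetric_eq[OF sym_arcs])
  qed
  have acyclic: "\<not> (\<exists>p. cycle p \<and> 3 \<le> length p)"
    using assms by (simp add: kary_rooted_tree_def undirected_tree_def)
  have ch: "children G \<rho> u = {v. u \<rightarrow> v \<and> depth v = Suc (depth u)}" if "u \<in> verts G" for u
  proof -
    have "real (depth v) = real (depth u) + 1 \<longleftrightarrow> depth v = Suc (depth u)" for v by linarith
    then show ?thesis
      using that adj_in_verts(2) by (auto simp: children_def graph_dist_depth)
  qed
  have inner: "card {v. u \<rightarrow> v \<and> depth v = Suc (depth u)} = k" if "u \<in> verts G" "depth u < r" for u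
    using assms(1) that by (simp add: kary_rooted_tree_def graph_dist_depth ch)
  have leaf: "v = w" if "u \<in> verts G" "depth u = r" "u \<rightarrow> v" "u \<rightarrow> w" for u v w
  proof -
    have "card (out_arcs G u) = 1"
      using assms(1) that by (simp add: kary_rooted_tree_def graph_dist_depth out_degree_def)
    then obtain e where "out_arcs G u = {e}" by (auto simp: card_1_singleton_iff)
    then have out: "e' \<in> arcs G \<Longrightarrow> tail G e' = u \<Longrightarrow> e' = e" for e'
      by (auto simp: out_arcs_def)
    have "z = head G e" if "u \<rightarrow> z" for z
      using that out by (auto simp: arcs_ends_conv)
    from this[of v] this[of w] show ?thesis using that(3,4) by simp
  qed
  define par where "par u = (SOME w. u \<rightarrow> w \<and> depth u = Suc (depth w))" for u
  have par: "u \<rightarrow> par u" "depth u = Suc (depth (par u))" if "u \<in> verts G" "u \<noteq> \<rho>" for u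
    using someI_ex[OF depth_predecessor[OF that]] by (simp_all add: par_def)
  \<comment> \<open>A parent at depth \<open>r\<close> is not the root because
    \<open>1 \<le> r\<close>. Its single neighbour would be both \<open>u\<close> and its own
    parent, whose depths differ by two.\<close>
  have depth_le_r: "depth u \<le> r" if "u \<in> verts G" for u
    using that
  proof (induction "depth u" arbitrary: u)
    case (Suc n)
    then have "u \<noteq> \<rho>" by auto
    note p = par[OF Suc(3) this]
    have P: "par u \<in> verts G" using p(1) adj_in_verts by blast
    have "depth (par u) \<le> r" using Suc P p(2) by simp
    moreover have "depth (par u) \<noteq> r"
    proof
      assume r: "depth (par u) = r"
      then have "par u \<noteq> \<rho>" using assms(2) depth_root by (metis not_one_le_zero)
      note pp = par[OF P this]
      have "u = par (par u)" using leaf[OF P r] p(1) pp(1) adj_sym by blast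
      then show False using p(2) pp(2) by simp
    qed
    ultimately show ?case using p(2) by simp
  qed simp
  have adj_iff: "u \<rightarrow> w \<longleftrightarrow> w \<in> verts G \<and> w \<noteq> \<rho> \<and> par w = u \<or> u \<noteq> \<rho> \<and> w = par u"
    if "u \<in> verts G" for u w
  proof
    assume a: "u \<rightarrow> w"
    then have w: "w \<in> verts G" using adj_in_verts by blast
    show "w \<in> verts G \<and> w \<noteq> \<rho> \<and> par w = u \<or> u \<noteq> \<rho> \<and> w = par u"
    \<comment> \<open>\<open>unique_predecessor\<close> admits equal depths, so it also excludes
      edges within a level: the end of an edge that is not deeper is the parent of the
      other.\<close>
    proof (cases "depth w \<le> depth u")
      case True
      have "u \<noteq> \<rho>"
        using True w depth_eq_0_iff[of w] adj_not_loop[OF a] by auto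
      then show ?thesis using unique_predecessor[OF acyclic a True] par[OF that] by simp
    next
      case False
      then have "w \<noteq> \<rho>" by auto
      then show ?thesis
        using False w par[OF w] unique_predecessor[OF acyclic, of w "par w" u] a adj_sym by auto
    qed
  qed (use par that adj_sym in blast)
  \<comment> \<open>By \<open>depth_le_r\<close> the truncated subtraction is exact.\<close>
  have "kary_levels G \<rho> k r (\<lambda>u. r - depth u) par"
  proof
    fix u assume u: "u \<in> verts G"
    show "{w. u \<rightarrow> w} = {w \<in> verts G. w \<noteq> \<rho> \<and> par w = u} \<union> (if u = \<rho> then {} else {par u})"
      using adj_iff[OF u] by auto
    show "card {w \<in> verts G. w \<noteq> \<rho> \<and> par w = u} = k" if "0 < r - depth u"
    proof -
      have "w \<in> verts G \<and> w \<noteq> \<rho> \<and> par w = u \<longleftrightarrow> u \<rightarrow> w \<and> depth w = Suc (depth u)" for w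
      proof
        show "u \<rightarrow> w \<and> depth w = Suc (depth u)" if "w \<in> verts G \<and> w \<noteq> \<rho> \<and> par w = u"
          using that par[of w] adj_sym by metis
        show "w \<in> verts G \<and> w \<noteq> \<rho> \<and> par w = u" if "u \<rightarrow> w \<and> depth w = Suc (depth u)"
        proof -
          have "w \<noteq> par u" if "u \<noteq> \<rho>"
          proof
            assume "w = par u"
            then have "depth u = Suc (depth w)" using par(2)[OF u that] by (rule ssubst)
            then show False using \<open>u \<rightarrow> w \<and> depth w = Suc (depth u)\<close> by linarith
          qed
          then show ?thesis using that adj_iff[OF u, of w] by blast
        qed
      qed
      then show ?thesis using inner[OF u] that by simp
    qed
    show "r - depth (par u) = Suc (r - depth u)" if "u \<noteq> \<rho>"
      using par[OF u that] depth_le_r[OF u] by simp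
    show "par u \<in> verts G" if "u \<noteq> \<rho>"
      using par[OF u that] adj_in_verts by blast
  qed (use root_in_verts in simp_all)
  then show ?thesis by blast
qed

theorem corollary1:
  fixes k r r' :: nat
    and G :: "('a, 'b) pre_digraph" and \<rho> :: 'a
    and G' :: "('c, 'd) pre_digraph" and \<rho>' :: 'c
  assumes "2 \<le> k" and "1 \<le> r" and "r \<le> r'"
    and "kary_rooted_tree k r G \<rho>"
    and "kary_rooted_tree k r' G' \<rho>'"
  shows "graph_spectrum G \<subseteq> graph_spectrum G'"
proof
  fix c assume c: "c \<in> graph_spectrum G"
  obtain height par where G: "kary_levels G \<rho> k r height par"
    using kary_rooted_tree_levels[OF assms(4,2)] by blast
  obtain height' par' where G': "kary_levels G' \<rho>' k r' height' par'"
    using kary_rooted_tree_levels[OF assms(5)] assms(2,3) by auto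
  obtain j where "j \<in> {1..Suc r}" "subtree_poly k c j = 0"
    using kary_levels.spectrum_iff[OF G assms(1)] c by blast
  \<comment> \<open>The polynomials depend on \<open>k\<close> but not on the depth of the tree, so
    the same \<open>j\<close> serves for both trees.\<close>
  moreover have "j \<in> {1..Suc r'}" using calculation(1) assms(3) by simp
  ultimately show "c \<in> graph_spectrum G'"
    using kary_levels.spectrum_iff[OF G' assms(1)] by blast
qed

end
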